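(* Let $G$ be a simple graph with vertex set $V=\{v_1,\ldots,v_n\}$ and edge set $E$, let $A=\{a_{ij}\}$ be a parameter list for $G$, and let $\Sigma_G(A)$ be the associated bigraphical arrangement. Then the map $R\mapsto \mathcal{O}_R$ is a bijection from the set of regions of $\Sigma_G(A)$ to the set of $A$-admissible partial orientations of $G$.
   Context: $G$ is a simple graph (no loops or multiple edges, not necessarily connected). A parameter list $A$ assigns to each edge $\{v_i,v_j\}\in E$ two real numbers $a_{ij}$ and $a_{ji}$, such that there exists $x\in\mathbb{R}^n$ with $x_i-x_j<a_{ij}$ and $x_j-x_i<a_{ji}$ for all $\{v_i,v_j\}\in E$. The bigraphical arrangement $\Sigma_G(A)$ is the set of $2|E|$ hyperplanes $\{x_i-x_j=a_{ij} : \{v_i,v_j\}\in E\}$ in $\mathbb{R}^n$ (one for each ordered pair). Its regions are the connected components of the complement of the union of these hyperplanes. A step is an ordered pair $(u,v)$ with $\{u,v\}\in E$. A partial orientation $\mathcal{O}$ is a set of steps such that $(u,v)\in\mathcal{O}$ implies $(v,u)\notin\mathcal{O}$; an edge $\{u,v\}$ with neither $(u,v)$ nor $(v,u)$ in $\mathcal{O}$ is called blank. For a region $R$, $\mathcal{O}_R$ is the partial orientation with $(v_i,v_j)\in\mathcal{O}_R$ iff $\{v_i,v_j\}\in E$ and $x_j>x_i+a_{ji}$ on $R$, all other edges blank. A step $(u,v)$ is compatible with $\mathcal{O}$ if $(v,u)\notin\mathcal{O}$. A potential cycle for $\mathcal{O}$ is a set of steps $\{(u_1,u_2),(u_2,u_3),\ldots,(u_k,u_1)\}$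 each compatible with $\mathcal{O}$. The score of a compatible step $e=(v_i,v_j)$ is $\nu_A(e,\mathcal{O})=a_{ij}$ if $\{v_i,v_j\}$ is blank, and $-a_{ji}$ if $(v_i,v_j)\in\mathcal{O}$; the score of a potential cycle is the sum of the scores of its steps. A potential cycle is bad if its score is $\le 0$, and $\mathcal{O}$ is $A$-admissible if it has no bad potential cycle. *)

theory Defs
  imports "HOL-Analysis.Analysis"
begin

text \<open>
  The vertices \<open>v\<^sub>1, \<dots>, v\<^sub>n\<close> are identified with the elements of a finite index type \<open>'n\<close>, so that
  the ambient space is \<open>real ^ 'n\<close>. The parameter \<open>a\<^sub>i\<^sub>j\<close> is \<open>a i j\<close>; the values of \<open>a\<close> at pairs that
  are not edges are never used.
\<close>

definition simple_graph :: "'n::finite set set \<Rightarrow> bool" where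
  "simple_graph E \<longleftrightarrow> (\<forall>e\<in>E. card e = 2)"

definition parameter_list :: "'n::finite set set \<Rightarrow> ('n \<Rightarrow> 'n \<Rightarrow> real) \<Rightarrow> bool" where
  "parameter_list E a \<longleftrightarrow>
     (\<exists>x::real^'n. \<forall>i j. {i, j} \<in> E \<longrightarrow> x $ i - x $ j < a i j \<and> x $ j - x $ i < a j i)"

definition bigraphical_arrangement ::
    "'n::finite set set \<Rightarrow> ('n \<Rightarrow> 'n \<Rightarrow> real) \<Rightarrow> (real^'n) set set" where
  "bigraphical_arrangement E a = {{x. x $ i - x $ j = a i j} | i j. {i, j} \<in> E}"

definition regions :: "(real^'n::finite) set set \<Rightarrow> (real^'n) set set" where
  "regions H = components (- \<Union>H)"

definition steps :: "'n::finite set set \<Rightarrow> ('n \<times> 'n) set" where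
  "steps E = {(u, v). {u, v} \<in> E}"

definition partial_orientation :: "'n::finite set set \<Rightarrow> ('n \<times> 'n) set \<Rightarrow> bool" where
  "partial_orientation E \<O> \<longleftrightarrow> \<O> \<subseteq> steps E \<and> (\<forall>u v. (u, v) \<in> \<O> \<longrightarrow> (v, u) \<notin> \<O>)"

definition region_orientation ::
    "'n::finite set set \<Rightarrow> ('n \<Rightarrow> 'n \<Rightarrow> real) \<Rightarrow> (real^'n) set \<Rightarrow> ('n \<times> 'n) set" where
  "region_orientation E a R = {(i, j). {i, j} \<in> E \<and> (\<forall>x\<in>R. x $ j > x $ i + a j i)}"

definition compatible :: "'n::finite set set \<Rightarrow> ('n \<times> 'n) set \<Rightarrow> 'n \<times> 'n \<Rightarrow> bool" where
  "compatible E \<O> e \<longleftrightarrow> e \<in> steps E \<and> (snd e, fst e) \<notin> \<O>"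

text \<open>
  For \<open>us = [u\<^sub>1, \<dots>, u\<^sub>k]\<close> the set below is \<open>{(u\<^sub>1, u\<^sub>2), \<dots>, (u\<^sub>k, u\<^sub>1)}\<close>. As usual for cycles,
  \<open>k \<ge> 1\<close> and the vertices \<open>u\<^sub>1, \<dots>, u\<^sub>k\<close> are distinct. Without distinctness, a closed walk using a step
  twice would contribute the score of that step only once, and the bijection would fail.
  The case \<open>k = 2\<close>, a blank edge traversed in both directions, is allowed.
\<close>

definition potential_cycle ::
    "'n::finite set set \<Rightarrow> ('n \<times> 'n) set \<Rightarrow> ('n \<times> 'n) set \<Rightarrow> bool" where
  "potential_cycle E \<O> C \<longleftrightarrow>
     (\<exists>us. us \<noteq> [] \<and> distinct us \<and> C = set (zip us (rotate1 us))) \<and>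
     (\<forall>e\<in>C. compatible E \<O> e)"

text \<open>Only used for compatible steps, which are blank exactly when they do not belong to \<open>\<O>\<close>.\<close>

definition score ::
    "('n::finite \<Rightarrow> 'n \<Rightarrow> real) \<Rightarrow> ('n \<times> 'n) set \<Rightarrow> 'n \<times> 'n \<Rightarrow> real" where
  "score a \<O> = (\<lambda>(i, j). if (i, j) \<in> \<O> then - a j i else a i j)"

definition bad_cycle ::
    "'n::finite set set \<Rightarrow> ('n \<Rightarrow> 'n \<Rightarrow> real) \<Rightarrow> ('n \<times> 'n) set \<Rightarrow> ('n \<times> 'n) set \<Rightarrow> bool" where
  "bad_cycle E a \<O> C \<longleftrightarrow> potential_cycle E \<O> C \<and> (\<Sum>e\<in>C. score a \<O> e) \<le> 0"

definition admissible ::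
    "'n::finite set set \<Rightarrow> ('n \<Rightarrow> 'n \<Rightarrow> real) \<Rightarrow> ('n \<times> 'n) set \<Rightarrow> bool" where
  "admissible E a \<O> \<longleftrightarrow> (\<nexists>C. bad_cycle E a \<O> C)"

end

theory Submission
  imports Defs
begin

text \<open>
  A point off the hyperplanes has orientation \<open>\<O>\<close> exactly when \<open>x\<^sub>i - x\<^sub>j\<close> is smaller than the score
  of \<open>(i, j)\<close> for every compatible step. These difference constraints define a convex set, so
  each orientation comes from at most one region. Adding up the constraints along a cycle
  shows that a feasible \<open>\<O>\<close> is admissible. Conversely, if all cycles have positive weight, the least
  weight of a path starting at a vertex is a feasible potential.
\<close>

section \<open>Systems of difference constraints\<close>

text \<open>A list instead of the set in \<open>potential_cycle\<close>, so that sums of weights can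
  be split along \<open>@\<close>; \<open>sum_set_cycle_steps\<close> leads back to sets.\<close>

definition cycle_steps :: "'a list \<Rightarrow> ('a \<times> 'a) list" where
  "cycle_steps us = zip us (rotate1 us)"

definition path_steps :: "'a list \<Rightarrow> ('a \<times> 'a) list" where
  "path_steps us = zip us (tl us)"

lemma path_steps_Cons:
  assumes "us \<noteq> []"
  shows "path_steps (u # us) = (u, hd us) # path_steps us"
  using assms by (cases us) (auto simp: path_steps_def)

text \<open>Cuts a walk at its return to the starting vertex, which allows a closed detour to be
  removed from a path.\<close>

lemma path_steps_split:
  "path_steps (u # us @ u # vs) = cycle_steps (u # us) @ path_steps (u # vs)"
proof -
  have "zip (u # us @ u # vs) (us @ u # vs) = zip ((u # us) @ (u # vs)) ((us @ [u]) @ vs)"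
    by simp
  also have "\<dots> = zip (u # us) (us @ [u]) @ zip (u # vs) vs"
    by (rule zip_append) simp
  finally show ?thesis by (simp add: path_steps_def cycle_steps_def)
qed

text \<open>The potential \<open>d u\<close> is the least weight of a simple path from
  \<open>u\<close>. Putting \<open>i\<close> before an optimal path from \<open>j\<close> gives a
  walk from \<open>i\<close> of weight \<open>w (i, j) + d j\<close>, and removing a possible cycle
  does not increase the weight.\<close>

lemma potential_of_nonneg_cycles:
  fixes F :: "('n::finite \<times> 'n) set" and w :: "'n \<times> 'n \<Rightarrow> real"
  assumes cyc: "\<And>us. us \<noteq> [] \<Longrightarrow> distinct us \<Longrightarrow> set (cycle_steps us) \<subseteq> F \<Longrightarrow>
      sum_list (map w (cycle_steps us)) \<ge> 0"
  shows "\<exists>x. \<forall>(i, j)\<in>F. x i - x j \<le> w (i, j)"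
proof -
  \<comment> \<open>The end of a path is left free: \<open>[u]\<close> always qualifies, so the
    minimum exists at every vertex, also in disconnected graphs.\<close>
  define paths where
    "paths u = {us. us \<noteq> [] \<and> hd us = u \<and> distinct us \<and> set (path_steps us) \<subseteq> F}" for u
  define W where "W us = sum_list (map w (path_steps us))" for us
  define d where "d u = Min (W ` paths u)" for u
  have fin: "finite (paths u)" for u
    by (rule finite_subset[OF _ finite_subset_distinct[OF finite[of UNIV]]])
      (auto simp: paths_def)
  have ne: "paths u \<noteq> {}" for u
  proof -
    have "[u] \<in> paths u" by (simp add: paths_def path_steps_def)
    then show ?thesis by blast
  qed
  have "d i - d j \<le> w (i, j)" if ij: "(i, j) \<in> F" for i j
  proof -
    have "d j \<in> W ` paths j"
      unfolding d_def using fin ne by (intro Min_in) auto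
    then obtain p where p: "p \<in> paths j" and dj: "d j = W p" by auto
    have step: "path_steps (i # p) = (i, j) # path_steps p"
      using p path_steps_Cons[of p i] by (auto simp: paths_def)
    have sub: "set (path_steps (i # p)) \<subseteq> F"
      using p ij unfolding step by (auto simp: paths_def)
    have Wip: "W (i # p) = w (i, j) + d j"
      unfolding W_def step dj by simp
    have "\<exists>q\<in>paths i. W q \<le> W (i # p)"
    proof (cases "i \<in> set p")
      case False
      then have "i # p \<in> paths i" using p sub by (auto simp: paths_def)
      then show ?thesis by blast
    next
      case True
      \<comment> \<open>As \<open>p\<close> is distinct, \<open>i\<close> occurs in it only once, so
        the detour \<open>i # p1\<close> is a simple cycle and the rest \<open>i # p2\<close> a
        simple path.\<close>
      then obtain p1 p2 where p12: "p = p1 @ i # p2" by (auto simp: in_set_conv_decomp)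
      have split: "path_steps (i # p) = cycle_steps (i # p1) @ path_steps (i # p2)"
        unfolding p12 by (rule path_steps_split)
      have dist: "distinct (i # p1)" "distinct (i # p2)"
        using p p12 by (auto simp: paths_def)
      have "sum_list (map w (cycle_steps (i # p1))) \<ge> 0"
        using sub dist unfolding split by (intro cyc) auto
      then have "W (i # p2) \<le> W (i # p)" unfolding W_def split by simp
      moreover have "i # p2 \<in> paths i"
        using sub dist unfolding split by (auto simp: paths_def)
      ultimately show ?thesis by blast
    qed
    then obtain q where "q \<in> paths i" "W q \<le> W (i # p)" by blast
    moreover from this have "d i \<le> W q" unfolding d_def using fin by (intro Min_le) auto
    ultimately show ?thesis using Wip by simp
  qed
  then show ?thesis by blast
qed

text \<open>There are finitely many simple cycles, so their mean weights per step have a positive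
  lower bound \<open>e\<close>. Lowering every weight by \<open>e\<close> keeps all cycles
  nonnegative and makes the resulting inequalities strict for \<open>w\<close>.\<close>

lemma strict_potential_of_pos_cycles:
  fixes F :: "('n::finite \<times> 'n) set" and w :: "'n \<times> 'n \<Rightarrow> real"
  assumes cyc: "\<And>us. us \<noteq> [] \<Longrightarrow> distinct us \<Longrightarrow> set (cycle_steps us) \<subseteq> F \<Longrightarrow>
      sum_list (map w (cycle_steps us)) > 0"
  shows "\<exists>x. \<forall>(i, j)\<in>F. x i - x j < w (i, j)"
proof -
  define cycles where
    "cycles = {us :: 'n list. us \<noteq> [] \<and> distinct us \<and> set (cycle_steps us) \<subseteq> F}"
  define mean where "mean us = sum_list (map w (cycle_steps us)) / length us" for us
  \<comment> \<open>The entry \<open>1\<close> keeps the minimum defined and positive when there are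
    no cycles.\<close>
  define e where "e = Min (insert 1 (mean ` cycles))"
  have "finite cycles"
    by (rule finite_subset[OF _ finite_subset_distinct[OF finite[of UNIV]]])
      (auto simp: cycles_def)
  then have fin: "finite (insert 1 (mean ` cycles))" by simp
  have "mean us > 0" if "us \<in> cycles" for us
    using cyc[of us] that by (auto simp: mean_def cycles_def)
  then have e: "e > 0" unfolding e_def using fin by (subst Min_gr_iff) auto
  have "\<exists>x. \<forall>(i, j)\<in>F. x i - x j \<le> (\<lambda>s. w s - e) (i, j)"
  proof (rule potential_of_nonneg_cycles)
    fix us :: "'n list"
    assume us: "us \<noteq> []" "distinct us" "set (cycle_steps us) \<subseteq> F"
    have "e \<le> mean us"
      unfolding e_def using fin us by (intro Min_le) (auto simp: cycles_def)
    then have "e * length us \<le> sum_list (map w (cycle_steps us))"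
      using us by (simp add: mean_def pos_le_divide_eq)
    moreover have "sum_list (map (\<lambda>s. w s - e) (cycle_steps us)) =
        sum_list (map w (cycle_steps us)) - e * length us"
      by (simp add: sum_list_subtractf sum_list_triv cycle_steps_def)
    ultimately show "sum_list (map (\<lambda>s. w s - e) (cycle_steps us)) \<ge> 0" by simp
  qed
  then obtain x where x: "\<And>i j. (i, j) \<in> F \<Longrightarrow> x i - x j \<le> w (i, j) - e" by fast
  have "x i - x j < w (i, j)" if "(i, j) \<in> F" for i j
    using x[OF that] e by simp
  then show ?thesis by blast
qed

text \<open>The heads of the steps are a rotation of their tails, so the sum telescopes.\<close>

lemma sum_cycle_differences:
  fixes x :: "'a \<Rightarrow> real"
  shows "(\<Sum>(i, j)\<leftarrow>cycle_steps us. x i - x j) = 0"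
proof -
  have "(\<Sum>(i, j)\<leftarrow>zip us vs. x i - x j) = sum_list (map x us) - sum_list (map x vs)"
    if "length us = length vs" for us vs
    using that by (induction us vs rule: list_induct2) auto
  moreover have "sum_list (map x (rotate1 us)) = sum_list (map x us)"
    by (cases us) auto
  ultimately show ?thesis by (simp add: cycle_steps_def)
qed

text \<open>Distinct vertices give steps with distinct first components, so the set loses no
  repetitions.\<close>

lemma sum_set_cycle_steps:
  "distinct us \<Longrightarrow> sum f (set (cycle_steps us)) = sum_list (map f (cycle_steps us))"
  by (simp add: cycle_steps_def distinct_zipI1 sum_list_distinct_conv_sum_set)

section \<open>The cell of a partial orientation\<close>

text \<open>A step of \<open>\<O>\<close> contributes the inequality that defines its orientation,
  its reverse contributes nothing, and a blank edge contributes the upper bounds in both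
  directions.\<close>

definition cell ::
    "'n::finite set set \<Rightarrow> ('n \<Rightarrow> 'n \<Rightarrow> real) \<Rightarrow> ('n \<times> 'n) set \<Rightarrow> (real^'n) set" where
  "cell E a \<O> = {x. \<forall>i j. compatible E \<O> (i, j) \<longrightarrow> x $ i - x $ j < score a \<O> (i, j)}"

definition point_orientation ::
    "'n::finite set set \<Rightarrow> ('n \<Rightarrow> 'n \<Rightarrow> real) \<Rightarrow> real^'n \<Rightarrow> ('n \<times> 'n) set" where
  "point_orientation E a x = {(i, j). {i, j} \<in> E \<and> x $ j > x $ i + a j i}"

lemma convex_cell:
  fixes E :: "'n::finite set set"
  shows "convex (cell E a \<O>)"
proof (rule convexI)
  fix x y :: "real^'n" and u v :: real
  assume x: "x \<in> cell E a \<O>" and y: "y \<in> cell E a \<O>" and uv: "0 \<le> u" "0 \<le> v" "u + v = 1"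
  show "u *\<^sub>R x + v *\<^sub>R y \<in> cell E a \<O>"
    unfolding cell_def
  proof (intro CollectI allI impI)
    fix i j assume "compatible E \<O> (i, j)"
    then have "x $ i - x $ j < score a \<O> (i, j)" "y $ i - y $ j < score a \<O> (i, j)"
      using x y by (auto simp: cell_def)
    then have "u * (x $ i - x $ j) + v * (y $ i - y $ j) < score a \<O> (i, j)"
      using uv by (intro convex_bound_lt)
    then show "(u *\<^sub>R x + v *\<^sub>R y) $ i - (u *\<^sub>R x + v *\<^sub>R y) $ j < score a \<O> (i, j)"
      by (simp add: algebra_simps)
  qed
qed

text \<open>Add the two inequalities at a common solution. Thus the two parallel hyperplanes of an
  edge bound a strip of positive width, where the edge is blank.\<close>

lemma parameter_list_pos:
  fixes E :: "'n::finite set set"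
  assumes "parameter_list E a" "{i, j} \<in> E"
  shows "a i j + a j i > 0"
proof -
  obtain x :: "real^'n" where "x $ i - x $ j < a i j" "x $ j - x $ i < a j i"
    using assms unfolding parameter_list_def by blast
  then show ?thesis by linarith
qed

lemma in_complement_iff:
  "x \<in> - \<Union>(bigraphical_arrangement E a) \<longleftrightarrow> (\<forall>i j. {i, j} \<in> E \<longrightarrow> x $ i - x $ j \<noteq> a i j)"
  by (auto simp: bigraphical_arrangement_def)

lemma partial_orientation_point_orientation:
  assumes "parameter_list E a"
  shows "partial_orientation E (point_orientation E a x)"
  using parameter_list_pos[OF assms]
  by (fastforce simp: partial_orientation_def point_orientation_def steps_def insert_commute)

lemma in_cell_point_orientation:
  assumes "x \<in> - \<Union>(bigraphical_arrangement E a)"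
  shows "x \<in> cell E a (point_orientation E a x)"
  unfolding cell_def
proof (intro CollectI allI impI)
  fix i j assume comp: "compatible E (point_orientation E a x) (i, j)"
  then have e: "{i, j} \<in> E" "{j, i} \<in> E"
    by (auto simp: compatible_def steps_def insert_commute)
  \<comment> \<open>For a step outside the orientation, compatibility gives only the weak bound by
    \<open>a i j\<close>; avoiding the hyperplane makes it strict.\<close>
  then have "x $ i - x $ j \<noteq> a i j" using assms unfolding in_complement_iff by blast
  then show "x $ i - x $ j < score a (point_orientation E a x) (i, j)"
    using comp e by (auto simp: compatible_def score_def point_orientation_def)
qed

text \<open>Inside a cell every edge has a strict inequality that decides whether each of its two
  steps is oriented, so \<open>\<O>\<close> can be read off from any point.\<close>

lemma
  assumes "parameter_list E a" "partial_orientation E \<O>" "x \<in> cell E a \<O>"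
  shows cell_in_complement: "x \<in> - \<Union>(bigraphical_arrangement E a)"
    and point_orientation_cell: "point_orientation E a x = \<O>"
proof -
  have gt: "x $ j > x $ i + a j i" if "(i, j) \<in> \<O>" for i j
  proof -
    have "compatible E \<O> (i, j)"
      using that assms(2) by (auto simp: compatible_def partial_orientation_def)
    then have "x $ i - x $ j < score a \<O> (i, j)" using assms(3) by (auto simp: cell_def)
    then show ?thesis using that by (simp add: score_def)
  qed
  have lt: "x $ j < x $ i + a j i" if "{i, j} \<in> E" "(i, j) \<notin> \<O>" for i j
  proof -
    have "compatible E \<O> (j, i)"
      using that by (auto simp: compatible_def steps_def insert_commute)
    then have "x $ j - x $ i < score a \<O> (j, i)" using assms(3) by (auto simp: cell_def)
    \<comment> \<open>Covers the case \<open>(j, i) \<in> \<O>\<close>, where the score is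
      \<open>- a i j\<close> instead of \<open>a j i\<close>.\<close>
    moreover have "- a i j < a j i" using parameter_list_pos[OF assms(1) that(1)] by simp
    ultimately show ?thesis by (simp add: score_def split: if_splits)
  qed
  show "x \<in> - \<Union>(bigraphical_arrangement E a)"
    unfolding in_complement_iff
  proof (intro allI impI)
    fix i j assume "{i, j} \<in> E"
    then show "x $ i - x $ j \<noteq> a i j"
      using gt[of j i] lt[of j i] by (cases "(j, i) \<in> \<O>") (auto simp: insert_commute)
  qed
  have "\<O> \<subseteq> steps E" using assms(2) by (simp add: partial_orientation_def)
  then show "point_orientation E a x = \<O>"
    using gt lt by (force simp: point_orientation_def steps_def)
qed

lemma admissible_if_cell_nonempty:
  assumes x: "x \<in> cell E a \<O>"
  shows "admissible E a \<O>"
  unfolding admissible_def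
proof
  assume "\<exists>C. bad_cycle E a \<O> C"
  then obtain us where us: "us \<noteq> []" "distinct us"
    and comp: "\<And>s. s \<in> set (cycle_steps us) \<Longrightarrow> compatible E \<O> s"
    and le: "(\<Sum>s\<in>set (cycle_steps us). score a \<O> s) \<le> 0"
    by (auto simp: bad_cycle_def potential_cycle_def cycle_steps_def)
  \<comment> \<open>Summing strict inequalities stays strict only over a nonempty set.\<close>
  have "cycle_steps us \<noteq> []"
    using us by (cases us) (auto simp: cycle_steps_def zip_eq_Nil_iff)
  then have "(\<Sum>(i, j)\<in>set (cycle_steps us). x $ i - x $ j) <
      (\<Sum>s\<in>set (cycle_steps us). score a \<O> s)"
    using comp x by (intro sum_strict_mono) (auto simp: cell_def)
  moreover have "(\<Sum>(i, j)\<in>set (cycle_steps us). x $ i - x $ j) = 0"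
    unfolding sum_set_cycle_steps[OF us(2)] by (rule sum_cycle_differences)
  ultimately show False using le by simp
qed

text \<open>Admissibility says that simple cycles of compatible steps have positive score, which is
  the hypothesis of \<open>strict_potential_of_pos_cycles\<close>.\<close>

lemma cell_nonempty_if_admissible:
  fixes E :: "'n::finite set set"
  assumes "admissible E a \<O>"
  shows "cell E a \<O> \<noteq> {}"
proof -
  have "\<exists>x. \<forall>(i, j)\<in>{s. compatible E \<O> s}. x i - x j < score a \<O> (i, j)"
  proof (rule strict_potential_of_pos_cycles)
    fix us :: "'n list"
    assume us: "us \<noteq> []" "distinct us" "set (cycle_steps us) \<subseteq> {s. compatible E \<O> s}"
    then have "potential_cycle E \<O> (set (cycle_steps us))"
      by (auto simp: potential_cycle_def cycle_steps_def)
    then have "\<not> (\<Sum>s\<in>set (cycle_steps us). score a \<O> s) \<le> 0"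
      using assms by (auto simp: admissible_def bad_cycle_def)
    then show "sum_list (map (score a \<O>) (cycle_steps us)) > 0"
      by (simp add: sum_set_cycle_steps us(2))
  qed
  then obtain x where
    "\<And>i j. compatible E \<O> (i, j) \<Longrightarrow> x i - x j < score a \<O> (i, j)" by fast
  then have "(\<chi> i. x i) \<in> cell E a \<O>" by (simp add: cell_def)
  then show ?thesis by blast
qed

section \<open>Regions\<close>

text \<open>By the intermediate value property, \<open>z $ j - z $ i\<close> cannot cross
  \<open>a j i\<close> on a connected set that avoids the hyperplane of \<open>(j, i)\<close>.
  Exchanging \<open>x\<close> and \<open>y\<close> gives equality.\<close>

lemma point_orientation_constant:
  assumes "connected R" "R \<subseteq> - \<Union>(bigraphical_arrangement E a)" "x \<in> R" "y \<in> R"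
  shows "point_orientation E a x \<subseteq> point_orientation E a y"
proof (clarsimp simp: point_orientation_def)
  fix i j assume e: "{i, j} \<in> E" and gt: "x $ i + a j i < x $ j"
  have e': "{j, i} \<in> E" using e by (simp add: insert_commute)
  show "y $ i + a j i < y $ j"
  proof (rule ccontr)
    assume "\<not> ?thesis"
    moreover have "connected ((\<lambda>z. z $ j - z $ i) ` R)"
      using assms(1) by (intro connected_continuous_image continuous_intros)
    ultimately have "a j i \<in> (\<lambda>z. z $ j - z $ i) ` R"
      using connectedD_interval[of _ "y $ j - y $ i" "x $ j - x $ i" "a j i"] assms(3,4) gt
      by auto
    then obtain z where "z \<in> R" "z $ j - z $ i = a j i" by auto
    then show False using assms(2) e' by (auto simp: bigraphical_arrangement_def)
  qed
qed

lemma region_orientation_eq: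
  assumes "R \<in> regions (bigraphical_arrangement E a)" "x \<in> R"
  shows "region_orientation E a R = point_orientation E a x"
proof -
  have "connected R" "R \<subseteq> - \<Union>(bigraphical_arrangement E a)"
    using assms(1) by (auto simp: regions_def dest: in_components_connected in_components_subset)
  then have "point_orientation E a x \<subseteq> point_orientation E a y" if "y \<in> R" for y
    using point_orientation_constant assms(2) that by blast
  then show ?thesis
    using assms(2) by (fastforce simp: region_orientation_def point_orientation_def)
qed

lemma region_point:
  assumes "R \<in> regions (bigraphical_arrangement E a)"
  obtains x where "x \<in> R" "x \<in> - \<Union>(bigraphical_arrangement E a)"
  using assms in_components_nonempty in_components_subset unfolding regions_def by blast

theorem mainTheorem1:
  fixes E :: "'n::finite set set" and a :: "'n \<Rightarrow> 'n \<Rightarrow> real"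
  assumes "simple_graph E" and "parameter_list E a"
  shows "bij_betw (region_orientation E a)
           (regions (bigraphical_arrangement E a))
           {\<O>. partial_orientation E \<O> \<and> admissible E a \<O>}"
proof (rule bij_betw_imageI)
  let ?M = "- \<Union>(bigraphical_arrangement E a)"
  note po = partial_orientation_point_orientation[OF assms(2)]
  show "inj_on (region_orientation E a) (regions (bigraphical_arrangement E a))"
  proof (rule inj_onI)
    fix R S
    assume R: "R \<in> regions (bigraphical_arrangement E a)"
      and S: "S \<in> regions (bigraphical_arrangement E a)"
      and eq: "region_orientation E a R = region_orientation E a S"
    obtain x where x: "x \<in> R" "x \<in> ?M" using region_point[OF R] .
    obtain y where y: "y \<in> S" "y \<in> ?M" using region_point[OF S] .
    let ?C = "cell E a (point_orientation E a x)"
    have "point_orientation E a y = point_orientation E a x"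
      using eq region_orientation_eq[OF R x(1)] region_orientation_eq[OF S y(1)] by simp
    then have mem: "x \<in> ?C" "y \<in> ?C"
      using in_cell_point_orientation[OF x(2)] in_cell_point_orientation[OF y(2)] by auto
    \<comment> \<open>The cell is a connected part of the complement that meets both
      \<open>R\<close> and \<open>S\<close>, so by maximality each of these components contains
      it.\<close>
    have "?C \<subseteq> ?M" using cell_in_complement[OF assms(2) po] by blast
    moreover have "connected ?C" by (rule convex_connected[OF convex_cell])
    ultimately have "?C \<subseteq> R" "?C \<subseteq> S"
      using components_maximal[of _ ?M ?C] R S x y mem unfolding regions_def by blast+
    then have "R \<inter> S \<noteq> {}" using mem by blast
    then show "R = S"
      using components_eq[of R ?M S] R S unfolding regions_def by simp
  qed
  show "region_orientation E a ` regions (bigraphical_arrangement E a) =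
      {\<O>. partial_orientation E \<O> \<and> admissible E a \<O>}"
  proof (intro equalityI subsetI)
    fix \<O> assume "\<O> \<in> region_orientation E a ` regions (bigraphical_arrangement E a)"
    then obtain R where R: "R \<in> regions (bigraphical_arrangement E a)"
      and \<O>: "\<O> = region_orientation E a R" by auto
    obtain x where x: "x \<in> R" "x \<in> ?M" using region_point[OF R] .
    have "\<O> = point_orientation E a x" using region_orientation_eq[OF R x(1)] \<O> by simp
    then show "\<O> \<in> {\<O>. partial_orientation E \<O> \<and> admissible E a \<O>}"
      using po admissible_if_cell_nonempty[OF in_cell_point_orientation[OF x(2)]] by simp
  next
    fix \<O> assume "\<O> \<in> {\<O>. partial_orientation E \<O> \<and> admissible E a \<O>}"
    then have \<O>: "partial_orientation E \<O>" "admissible E a \<O>" by auto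
    obtain x where x: "x \<in> cell E a \<O>" using cell_nonempty_if_admissible[OF \<O>(2)] by blast
    \<comment> \<open>The preimage of \<open>\<O>\<close> is the component of any point of its
      cell.\<close>
    let ?R = "connected_component_set ?M x"
    have M: "x \<in> ?M" by (rule cell_in_complement[OF assms(2) \<O>(1) x])
    then have R: "?R \<in> regions (bigraphical_arrangement E a)"
      unfolding regions_def by (rule componentsI)
    have "x \<in> ?R" using M by simp
    from region_orientation_eq[OF R this] point_orientation_cell[OF assms(2) \<O>(1) x]
    have "region_orientation E a ?R = \<O>" by (rule trans)
    then show "\<O> \<in> region_orientation E a ` regions (bigraphical_arrangement E a)"
      using R by blast
  qed
qed

end
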